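(* Let $m \ge 1$ be an integer, let $0<\alpha<1$, and let $N \subseteq \{1,\dots,m\}$. Let $p_1,\dots,p_m \in (0,1)$ be $p$-values such that those with index in $N$ (the null $p$-values) are independent and uniformly distributed on $[0,1]$, while the $p$-values with index not in $N$ are arbitrary fixed numbers in $(0,1)$. Define $$\hat{k}_F = \max\left\{k \in \{1,\dots,m\} : \frac{1}{k}\sum_{i=1}^k Y_i \le \alpha\right\}, \qquad Y_i = -\log(1-p_i),$$ with the convention $\max(\emptyset)=0$. Then $$\mathbb{E}\left[\frac{\left|\{1,\dots,\hat{k}_F\}\cap N\right|}{\max\{\hat{k}_F,\,1\}}\right] \le \alpha.$$
   Context: There are ordered hypotheses $H_1,\dots,H_m$ with $p$-values $p_1,\dots,p_m$, and a procedure must reject an initial block $H_1,\dots,H_{\hat k}$. The procedure rejecting $H_1,\dots,H_{\hat k_F}$ is called ForwardStop. When $\hat k_F=0$ the set $\{1,\dots,\hat k_F\}$ is empty. The analysis is conditional on the non-null $p$-values, i.e. they are treated as deterministic constants. *)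

theory Defs
  imports "HOL-Probability.Probability"
begin

definition forward_stop_stat :: "(nat \<Rightarrow> real) \<Rightarrow> nat \<Rightarrow> real" where
  "forward_stop_stat p i = - ln (1 - p i)"

definition forward_stop_candidates :: "real \<Rightarrow> nat \<Rightarrow> (nat \<Rightarrow> real) \<Rightarrow> nat set" where
  "forward_stop_candidates \<alpha> m p =
     {k \<in> {1..m}. (1 / real k) * (\<Sum>i=1..k. forward_stop_stat p i) \<le> \<alpha>}"

(* Max {} is unspecified in the library, so max(empty) = 0 is made explicit. *)
definition forward_stop :: "real \<Rightarrow> nat \<Rightarrow> (nat \<Rightarrow> real) \<Rightarrow> nat" where
  "forward_stop \<alpha> m p =
     (if forward_stop_candidates \<alpha> m p = {} then 0
      else Max (forward_stop_candidates \<alpha> m p))"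

definition false_discovery_proportion :: "nat set \<Rightarrow> nat \<Rightarrow> real" where
  "false_discovery_proportion N k = real (card ({1..k} \<inter> N)) / real (max k 1)"

end

theory Submission
  imports Defs
begin

text \<open>
  Let \<open>T\<^sub>k\<close> be the sum of the null statistics among the first \<open>k\<close>, \<open>j\<close> the number of these
  nulls, and \<open>X\<^sub>k\<close> the false discovery proportion of the procedure restricted to \<open>H\<^sub>1, \<dots>, H\<^sub>k\<close>.
  The null statistics are i.i.d. standard exponential, so tilting by \<open>exp T\<^sub>k\<close> turns their joint
  law into Lebesgue measure, and one shows by induction on the last null that
  \<open>E[X\<^sub>k exp(T\<^sub>k) 1{T\<^sub>k \<le> t}] \<le> \<alpha> t\<^bsup>j-1\<^esup> / (j-1)!\<close> for \<open>t > 0\<close>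
  (read as \<open>0\<close> for \<open>j = 0\<close>, hence the form \<open>j t\<^bsup>j-1\<^esup> / j!\<close> below).
  If \<open>q\<close> is the last null up to \<open>k\<close>, there is a threshold \<open>C\<close> with \<open>X\<^sub>k \<le> \<alpha> j / C\<close> when
  \<open>T\<^sub>k \<le> C\<close> and \<open>X\<^sub>k = X\<^bsub>q-1\<^esub>\<close> otherwise. The first event contributes at most
  \<open>\<alpha> C\<^bsup>j-1\<^esup> / (j-1)!\<close>, and integrating the induction hypothesis over \<open>(C, t]\<close> supplies exactly
  the remaining \<open>\<alpha> (t\<^bsup>j-1\<^esup> - C\<^bsup>j-1\<^esup>) / (j-1)!\<close>. Integrating the bound against \<open>exp(-t)\<close>
  over \<open>t > 0\<close> removes the tilt and gives \<open>\<alpha>\<close>.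
\<close>

section \<open>Deterministic part: statistics, stopping index and rejection thresholds\<close>

definition null_stat_sum :: "nat set \<Rightarrow> nat \<Rightarrow> (nat \<Rightarrow> real) \<Rightarrow> real" where
  "null_stat_sum N k x = (\<Sum>i\<in>N \<inter> {1..k}. forward_stop_stat x i)"

lemma forward_stop_stat_pos:
  assumes "0 < x i" "x i < 1"
  shows "0 < forward_stop_stat x i"
  using assms by (simp add: forward_stop_stat_def)

lemma null_stat_sum_nonneg:
  assumes "\<And>i. i \<in> {1..k} \<Longrightarrow> 0 < x i \<and> x i < 1"
  shows "0 \<le> null_stat_sum N k x"
  unfolding null_stat_sum_def
  by (intro sum_nonneg less_imp_le forward_stop_stat_pos) (use assms in auto)

lemma null_stat_sum_pos:
  assumes "\<And>i. i \<in> {1..k} \<Longrightarrow> 0 < x i \<and> x i < 1" "q \<in> N \<inter> {1..k}"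
  shows "0 < null_stat_sum N k x"
  unfolding null_stat_sum_def
  by (rule sum_pos) (use assms in \<open>auto intro!: forward_stop_stat_pos\<close>)

text \<open>With the non-null values fixed at \<open>c\<close>, the rejection condition at an index
  becomes an upper bound on the null sum alone.\<close>

lemma sum_forward_stop_stat_split:
  assumes "\<And>i. i \<in> {1..k} - N \<Longrightarrow> x i = c i"
  shows "(\<Sum>i=1..k. forward_stop_stat x i)
           = null_stat_sum N k x + (\<Sum>i\<in>{1..k} - N. forward_stop_stat c i)"
proof -
  have "(\<Sum>i=1..k. forward_stop_stat x i)
          = (\<Sum>i\<in>{1..k} \<inter> N. forward_stop_stat x i) + (\<Sum>i\<in>{1..k} - N. forward_stop_stat x i)"
    by (rule sum.Int_Diff) simp
  also have "(\<Sum>i\<in>{1..k} - N. forward_stop_stat x i) = (\<Sum>i\<in>{1..k} - N. forward_stop_stat c i)"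
    by (rule sum.cong) (use assms in \<open>auto simp: forward_stop_stat_def\<close>)
  finally show ?thesis by (simp add: null_stat_sum_def Int_commute)
qed

lemma forward_stop_0 [simp]: "forward_stop \<alpha> 0 x = 0"
  by (simp add: forward_stop_def forward_stop_candidates_def)

text \<open>Replaces the maximum by a recursion on the number of hypotheses, since only the newest
  index can enlarge the candidate set. The later inductions over truncated procedures rest on
  this.\<close>

lemma forward_stop_Suc:
  "forward_stop \<alpha> (Suc k) x =
     (if (\<Sum>i=1..Suc k. forward_stop_stat x i) \<le> \<alpha> * Suc k then Suc k else forward_stop \<alpha> k x)"
proof -
  let ?C = "\<lambda>k. forward_stop_candidates \<alpha> k x"
  have cand: "?C (Suc k) =
      (if (\<Sum>i=1..Suc k. forward_stop_stat x i) \<le> \<alpha> * Suc k then insert (Suc k) (?C k) else ?C k)"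
    unfolding forward_stop_candidates_def
    by (auto simp: le_Suc_eq field_simps simp del: sum.cl_ivl_Suc of_nat_Suc)
  have fin: "finite (?C k)" and bound: "\<And>i. i \<in> ?C k \<Longrightarrow> i \<le> Suc k"
    by (auto simp: forward_stop_candidates_def)
  have "Max (insert (Suc k) (?C k)) = Suc k"
    using fin bound by (intro Max_eqI) auto
  then show ?thesis
    by (simp add: forward_stop_def cand del: sum.cl_ivl_Suc)
qed

lemma forward_stop_cong:
  assumes "\<And>i. i \<in> {1..k} \<Longrightarrow> x i = y i"
  shows "forward_stop \<alpha> k x = forward_stop \<alpha> k y"
  using assms
proof (induction k)
  case (Suc k)
  have "(\<Sum>i=1..Suc k. forward_stop_stat x i) = (\<Sum>i=1..Suc k. forward_stop_stat y i)"
    by (rule sum.cong) (use Suc.prems in \<open>auto simp: forward_stop_stat_def\<close>)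
  then show ?case
    using Suc by (simp add: forward_stop_Suc del: sum.cl_ivl_Suc)
qed simp

lemma forward_stop_le: "forward_stop \<alpha> k x \<le> k"
  by (induction k) (simp_all add: forward_stop_Suc)

lemma false_discovery_proportion_nonneg: "0 \<le> false_discovery_proportion N k"
  by (simp add: false_discovery_proportion_def)

lemma false_discovery_proportion_no_null:
  assumes "N \<inter> {1..k} = {}" "l \<le> k"
  shows "false_discovery_proportion N l = 0"
proof -
  have "{1..l} \<inter> N = {}" using assms by auto
  then show ?thesis by (simp add: false_discovery_proportion_def)
qed

text \<open>
  Along a run of non-nulls the rejection thresholds for the null sum may oscillate; only their
  maximum \<open>C\<close> matters, because a null sum below a smaller threshold reached earlier in the run
  is also below \<open>C\<close> and then a later, larger index is rejected. For \<open>C = 0\<close> the first branch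
  is void since the null sum is positive.
\<close>
lemma fdp_threshold:
  fixes \<alpha> :: real and N :: "nat set" and q k :: nat
  assumes "q \<le> k" "1 \<le> q" "q \<in> N" "N \<inter> {q<..k} = {}" "0 < \<alpha>"
    and "\<And>i. i \<in> {1..k} - N \<Longrightarrow> 0 < c i \<and> c i < 1"
  shows "\<exists>C. 0 \<le> C \<and> C \<le> \<alpha> * k \<and>
    (\<forall>x. (\<forall>i\<in>{1..k}. 0 < x i \<and> x i < 1) \<longrightarrow> (\<forall>i\<in>{1..k} - N. x i = c i) \<longrightarrow>
      false_discovery_proportion N (forward_stop \<alpha> k x) \<le>
        (if null_stat_sum N k x \<le> C then \<alpha> * card (N \<inter> {1..k}) / C
         else false_discovery_proportion N (forward_stop \<alpha> (q - 1) x)))"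
  using assms
proof (induction k rule: dec_induct)
  case base
  define a where "a = (\<Sum>i\<in>{1..q} - N. forward_stop_stat c i)"
  \<comment> \<open>Index \<open>q\<close> is rejected iff the null sum is at most
    \<open>\<alpha> * q - a\<close>. Truncating at 0 keeps \<open>C\<close> nonnegative and changes
    nothing, as the null sum is positive.\<close>
  define C where "C = max 0 (\<alpha> * q - a)"
  have "0 \<le> a" unfolding a_def
    by (intro sum_nonneg less_imp_le forward_stop_stat_pos) (use base in auto)
  then have Cq: "C \<le> \<alpha> * q" using \<open>0 < \<alpha>\<close> by (auto simp: C_def)
  show ?case
  proof (intro exI[of _ C] conjI allI impI)
    show "0 \<le> C" by (simp add: C_def)
    show "C \<le> \<alpha> * q" by (fact Cq)
    fix x :: "nat \<Rightarrow> real"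
    assume x: "\<forall>i\<in>{1..q}. 0 < x i \<and> x i < 1" "\<forall>i\<in>{1..q} - N. x i = c i"
    have T: "0 < null_stat_sum N q x"
      by (rule null_stat_sum_pos[of _ _ q]) (use x base in auto)
    have sum: "(\<Sum>i=1..q. forward_stop_stat x i) = null_stat_sum N q x + a"
      unfolding a_def by (rule sum_forward_stop_stat_split) (use x in auto)
    have rec: "forward_stop \<alpha> q x = (if null_stat_sum N q x \<le> C then q else forward_stop \<alpha> (q - 1) x)"
      using forward_stop_Suc[of \<alpha> "q - 1" x] \<open>1 \<le> q\<close> T sum
      by (auto simp: C_def max_def)
    \<comment> \<open>The bound \<open>C \<le> \<alpha> * q\<close> trades the rejected index for
      the threshold: \<open>1 / q \<le> \<alpha> / C\<close>.\<close>
    have "real (card ({1..q} \<inter> N)) / q \<le> \<alpha> * card (N \<inter> {1..q}) / C" if "0 < C"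
    proof -
      have "real (card ({1..q} \<inter> N)) * C \<le> real (card ({1..q} \<inter> N)) * (\<alpha> * q)"
        by (intro mult_left_mono Cq) auto
      then show ?thesis using that \<open>1 \<le> q\<close> by (simp add: field_simps Int_commute)
    qed
    then show "false_discovery_proportion N (forward_stop \<alpha> q x) \<le>
        (if null_stat_sum N q x \<le> C then \<alpha> * card (N \<inter> {1..q}) / C
         else false_discovery_proportion N (forward_stop \<alpha> (q - 1) x))"
      using T rec \<open>1 \<le> q\<close> by (auto simp: false_discovery_proportion_def max_def)
  qed
next
  case (step k)
  have "N \<inter> {q<..k} = {}" using step.prems(3) by auto
  with step.IH step.prems obtain C where C: "0 \<le> C" "C \<le> \<alpha> * k"
    and IH: "\<And>x. \<lbrakk>\<forall>i\<in>{1..k}. 0 < x i \<and> x i < 1; \<forall>i\<in>{1..k} - N. x i = c i\<rbrakk> \<Longrightarrow>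
      false_discovery_proportion N (forward_stop \<alpha> k x) \<le>
        (if null_stat_sum N k x \<le> C then \<alpha> * card (N \<inter> {1..k}) / C
         else false_discovery_proportion N (forward_stop \<alpha> (q - 1) x))"
    by auto
  have "Suc k \<notin> N" using step by auto
  then have Nk: "N \<inter> {1..Suc k} = N \<inter> {1..k}" by (auto simp: le_Suc_eq)
  define a where "a = (\<Sum>i\<in>{1..Suc k} - N. forward_stop_stat c i)"
  define d where "d = \<alpha> * Suc k - a"
  define j where "j = card (N \<inter> {1..k})"
  have "0 \<le> a" unfolding a_def
    by (intro sum_nonneg less_imp_le forward_stop_stat_pos) (use step in auto)
  then have d: "d \<le> \<alpha> * Suc k" by (simp add: d_def)
  have Ck: "C \<le> \<alpha> * Suc k" using C \<open>0 < \<alpha>\<close> by (simp add: algebra_simps)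
  show ?case
  proof (intro exI[of _ "max C d"] conjI allI impI)
    show "0 \<le> max C d" using C by simp
    show "max C d \<le> \<alpha> * Suc k" using Ck d by simp
    fix x :: "nat \<Rightarrow> real"
    assume x: "\<forall>i\<in>{1..Suc k}. 0 < x i \<and> x i < 1" "\<forall>i\<in>{1..Suc k} - N. x i = c i"
    define T where "T = null_stat_sum N k x"
    have T: "0 < T" unfolding T_def
      by (rule null_stat_sum_pos[of _ _ q]) (use x step in auto)
    have T_Suc: "null_stat_sum N (Suc k) x = T" by (simp only: T_def null_stat_sum_def Nk)
    have sum: "(\<Sum>i=1..Suc k. forward_stop_stat x i) = T + a"
      unfolding a_def T_Suc[symmetric] by (rule sum_forward_stop_stat_split) (use x in auto)
    have rec: "forward_stop \<alpha> (Suc k) x = (if T \<le> d then Suc k else forward_stop \<alpha> k x)"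
      using forward_stop_Suc[of \<alpha> k x] sum by (auto simp: d_def)
    have le: "false_discovery_proportion N (Suc k) \<le> \<alpha> * j / max C d" if "0 < max C d"
    proof -
      have "real j * max C d \<le> real j * (\<alpha> * Suc k)"
        by (intro mult_left_mono) (use Ck d in auto)
      then have "real j / Suc k \<le> \<alpha> * j / max C d"
        using that by (simp add: field_simps del: of_nat_Suc)
      moreover have "card ({1..Suc k} \<inter> N) = j"
        by (simp only: j_def Nk Int_commute[of "{1..Suc k}"])
      ultimately show ?thesis
        by (simp add: false_discovery_proportion_def del: of_nat_Suc)
    qed
    show "false_discovery_proportion N (forward_stop \<alpha> (Suc k) x) \<le>
        (if null_stat_sum N (Suc k) x \<le> max C d then \<alpha> * card (N \<inter> {1..Suc k}) / max C d
         else false_discovery_proportion N (forward_stop \<alpha> (q - 1) x))"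
    proof (cases "T \<le> d")
      case True
      then have "T \<le> max C d" by simp
      with True show ?thesis using rec le T T_Suc unfolding Nk by (simp add: j_def)
    next
      case False
      \<comment> \<open>Since \<open>T > d\<close>, the condition \<open>T \<le> max C d\<close> is
        equivalent to \<open>T \<le> C\<close>, and in that case \<open>max C d = C\<close>. Both
        branches of the induction hypothesis therefore carry over unchanged.\<close>
      have "false_discovery_proportion N (forward_stop \<alpha> k x) \<le>
          (if T \<le> C then \<alpha> * j / C else false_discovery_proportion N (forward_stop \<alpha> (q - 1) x))"
        unfolding T_def j_def by (rule IH) (use x in auto)
      then show ?thesis using False rec T_Suc unfolding Nk
        by (auto simp: j_def max_def)
    qed
  qed
qed

section \<open>Exponential law, tilting and measurability\<close>

lemma (in prob_space) exponential_distributed_of_uniform: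
  fixes X :: "'a \<Rightarrow> real"
  assumes D: "distributed M lborel X (\<lambda>x. indicator {0..1} x / measure lborel {0..1::real})"
    and range: "\<And>\<omega>. \<omega> \<in> space M \<Longrightarrow> X \<omega> < 1"
  shows "distributed M lborel (\<lambda>\<omega>. - ln (1 - X \<omega>)) (exponential_density 1)"
proof -
  have X [measurable]: "X \<in> borel_measurable M"
    using distributed_measurable[OF D] by simp
  have "\<P>(\<omega> in M. - ln (1 - X \<omega>) \<le> a) = 1 - exp (- a)" if "0 \<le> a" for a
  proof -
    \<comment> \<open>Inversion of the distribution function; \<open>X \<omega> < 1\<close> keeps
      the argument of \<open>ln\<close> positive.\<close>
    have "- ln (1 - X \<omega>) \<le> a \<longleftrightarrow> X \<omega> \<le> 1 - exp (- a)" if "\<omega> \<in> space M" for \<omega>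
    proof -
      have "- ln (1 - X \<omega>) \<le> a \<longleftrightarrow> - a \<le> ln (1 - X \<omega>)" by linarith
      also have "\<dots> \<longleftrightarrow> exp (- a) \<le> 1 - X \<omega>" using range[OF that] by (simp add: ln_ge_iff)
      finally show ?thesis by linarith
    qed
    then have "\<P>(\<omega> in M. - ln (1 - X \<omega>) \<le> a) = \<P>(\<omega> in M. X \<omega> \<le> 1 - exp (- a))"
      by (intro arg_cong[where f = prob] Collect_cong) auto
    also have "\<dots> = 1 - exp (- a)"
      using uniform_distributed_measure[OF D, of "1 - exp (- a)"] that by simp
    finally show ?thesis .
  qed
  then show ?thesis by (subst exponential_distributed_iff) auto
qed

text \<open>
  The tilt \<open>exp\<close> cancels the exponential density, so adding an independent exponential variable
  to \<open>\<tau> W\<close> becomes plain integration over the level \<open>s\<close>.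
\<close>
lemma (in prob_space) nn_integral_tilted_add_exponential:
  fixes \<eta> \<tau> :: "'b \<Rightarrow> real" and G :: "'b \<Rightarrow> ennreal"
  assumes indep: "indep_var S W R U"
    and G [measurable]: "G \<in> borel_measurable S" and \<tau> [measurable]: "\<tau> \<in> borel_measurable S"
    and \<eta> [measurable]: "\<eta> \<in> borel_measurable R"
    and D: "distributed M lborel (\<lambda>\<omega>. \<eta> (U \<omega>)) (exponential_density 1)"
  shows "(\<integral>\<^sup>+\<omega>. G (W \<omega>) * ennreal (exp (\<tau> (W \<omega>) + \<eta> (U \<omega>)))
            * indicator {a<..t} (\<tau> (W \<omega>) + \<eta> (U \<omega>)) \<partial>M)
    = (\<integral>\<^sup>+s. (\<integral>\<^sup>+\<omega>. G (W \<omega>) * ennreal (exp (\<tau> (W \<omega>))) * indicator {..s} (\<tau> (W \<omega>)) \<partial>M)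
            * indicator {a<..t} s \<partial>lborel)"
proof -
  have W [measurable]: "W \<in> measurable M S" and U [measurable]: "U \<in> measurable M R"
    using indep by (auto dest: indep_var_rv1 indep_var_rv2)
  interpret W: prob_space "distr M S W" by (rule prob_space_distr) simp
  interpret U: prob_space "distr M R U" by (rule prob_space_distr) simp
  interpret WL: pair_sigma_finite "distr M S W" "lborel :: real measure" ..
  have distr_\<eta>: "distr (distr M R U) lborel \<eta> = density lborel (exponential_density 1)"
    using distributed_distr_eq_density[OF D] by (simp add: distr_distr comp_def)
  have joint: "distr M S W \<Otimes>\<^sub>M distr M R U = distr M (S \<Otimes>\<^sub>M R) (\<lambda>\<omega>. (W \<omega>, U \<omega>))"
    using indep by (simp add: indep_var_distribution_eq)
  let ?F = "\<lambda>w y. G w * ennreal (exp (\<tau> w + y)) * indicator {a<..t} (\<tau> w + y)"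
  let ?E = "\<lambda>w. G w * ennreal (exp (\<tau> w))"
  have shift: "(\<integral>\<^sup>+u. ?F w (\<eta> u) \<partial>distr M R U)
      = (\<integral>\<^sup>+s. ?E w * indicator {..s} (\<tau> w) * indicator {a<..t} s \<partial>lborel)" for w
  proof -
    have "(\<integral>\<^sup>+u. ?F w (\<eta> u) \<partial>distr M R U) = (\<integral>\<^sup>+y. ?F w y \<partial>distr (distr M R U) lborel \<eta>)"
      by (rule nn_integral_distr[symmetric]) auto
    also have "\<dots> = (\<integral>\<^sup>+y. ennreal (exponential_density 1 y) * ?F w y \<partial>lborel)"
      unfolding distr_\<eta> by (rule nn_integral_density) auto
    \<comment> \<open>The support condition \<open>0 \<le> y\<close> of the density is recorded as
      \<open>\<tau> w \<le> \<tau> w + y\<close>, so that the translation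
      \<open>s = \<tau> w + y\<close> turns it into \<open>\<tau> w \<le> s\<close>.\<close>
    also have "\<dots> = (\<integral>\<^sup>+y. ?E w * indicator {..\<tau> w + y} (\<tau> w) * indicator {a<..t} (\<tau> w + y) \<partial>lborel)"
    proof (rule nn_integral_cong)
      fix y :: real
      have "ennreal (exp (- y)) * ennreal (exp (\<tau> w + y)) = ennreal (exp (\<tau> w))"
        by (simp add: ennreal_mult[symmetric] exp_add[symmetric])
      then have "ennreal (exp (- y)) * (G w * ennreal (exp (\<tau> w + y))) = ?E w"
        by (metis mult.left_commute)
      then show "ennreal (exponential_density 1 y) * ?F w y
          = ?E w * indicator {..\<tau> w + y} (\<tau> w) * indicator {a<..t} (\<tau> w + y)"
        by (auto simp: exponential_density_def split: split_indicator)
    qed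
    also have "\<dots> = (\<integral>\<^sup>+s. ?E w * indicator {..s} (\<tau> w) * indicator {a<..t} s \<partial>lborel)"
      using nn_integral_real_affine[of "\<lambda>s. ?E w * indicator {..s} (\<tau> w) * indicator {a<..t} s" 1 "\<tau> w"]
      by (simp add: indicator_def of_bool_def)
    finally show ?thesis .
  qed
  have "(\<integral>\<^sup>+\<omega>. ?F (W \<omega>) (\<eta> (U \<omega>)) \<partial>M)
      = (\<integral>\<^sup>+z. ?F (fst z) (\<eta> (snd z)) \<partial>(distr M S W \<Otimes>\<^sub>M distr M R U))"
    unfolding joint by (subst nn_integral_distr) auto
  also have "\<dots> = (\<integral>\<^sup>+w. (\<integral>\<^sup>+u. ?F w (\<eta> u) \<partial>distr M R U) \<partial>distr M S W)"
    by (subst U.nn_integral_fst[symmetric]) auto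
  also have "\<dots> = (\<integral>\<^sup>+w. (\<integral>\<^sup>+s. ?E w * indicator {..s} (\<tau> w) * indicator {a<..t} s \<partial>lborel) \<partial>distr M S W)"
    unfolding shift ..
  also have "\<dots> = (\<integral>\<^sup>+s. (\<integral>\<^sup>+w. ?E w * indicator {..s} (\<tau> w) * indicator {a<..t} s \<partial>distr M S W) \<partial>lborel)"
  proof (rule WL.Fubini'[symmetric])
    \<comment> \<open>The set \<open>{..s}\<close> moves with an integration variable, so joint
      measurability is checked on the conditional form of its indicator.\<close>
    have "(\<lambda>(w, s). ?E w * (if \<tau> w \<le> s then 1 else 0) * indicator {a<..t} s)
        \<in> borel_measurable (distr M S W \<Otimes>\<^sub>M lborel)" by measurable
    then show "(\<lambda>(w, s). ?E w * indicator {..s} (\<tau> w) * indicator {a<..t} s)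
        \<in> borel_measurable (distr M S W \<Otimes>\<^sub>M lborel)"
      by (simp add: indicator_def of_bool_def)
  qed
  also have "\<dots> = (\<integral>\<^sup>+s. (\<integral>\<^sup>+w. ?E w * indicator {..s} (\<tau> w) \<partial>distr M S W) * indicator {a<..t} s \<partial>lborel)"
    by (intro nn_integral_cong nn_integral_multc) auto
  also have "\<dots> = (\<integral>\<^sup>+s. (\<integral>\<^sup>+\<omega>. ?E (W \<omega>) * indicator {..s} (\<tau> (W \<omega>)) \<partial>M) * indicator {a<..t} s \<partial>lborel)"
    by (subst nn_integral_distr) auto
  finally show ?thesis .
qed

text \<open>The integrand is the derivative of \<open>\<alpha> * s ^ j / fact j\<close>. Written
  with the factor \<open>j\<close>, it also covers \<open>j = 0\<close>, where both sides
  vanish.\<close>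

lemma nn_integral_scaled_power_deriv:
  fixes \<alpha> a t :: real
  assumes "0 \<le> a" "a \<le> t" "0 \<le> \<alpha>"
  shows "(\<integral>\<^sup>+s. ennreal (\<alpha> * (real j * s ^ (j - 1) / fact j)) * indicator {a<..t} s \<partial>lborel)
    = ennreal (\<alpha> * (t ^ j - a ^ j) / fact j)"
proof -
  have "(\<integral>\<^sup>+s. ennreal (\<alpha> * (real j * s ^ (j - 1) / fact j)) * indicator {a<..t} s \<partial>lborel)
      = (\<integral>\<^sup>+s. ennreal (\<alpha> * (real j * s ^ (j - 1) / fact j)) * indicator {a..t} s \<partial>lborel)"
    by (intro nn_integral_cong_AE AE_I[where N = "{a}"]) (auto split: split_indicator)
  also have "\<dots> = ennreal (\<alpha> * (t ^ j / fact j) - \<alpha> * (a ^ j / fact j))"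
    using assms by (intro nn_integral_FTC_Icc) (auto intro!: derivative_eq_intros)
  finally show ?thesis by (simp add: diff_divide_distrib right_diff_distrib)
qed

lemma measurable_null_stat_sum:
  assumes "N \<inter> {1..k} \<subseteq> I"
  shows "null_stat_sum N k \<in> borel_measurable (PiM I (\<lambda>_. borel))"
proof -
  have "(\<lambda>x. null_stat_sum N k x) \<in> borel_measurable (PiM I (\<lambda>_. borel))"
    unfolding null_stat_sum_def forward_stop_stat_def
    by (intro borel_measurable_sum borel_measurable_uminus borel_measurable_ln borel_measurable_diff
          borel_measurable_const measurable_component_singleton) (use assms in auto)
  then show ?thesis by simp
qed

text \<open>The recursion for \<open>forward_stop\<close> reduces measurability to that of finitely
  many comparisons. The source space is left general because the lemma serves both the sample space
  and the product space of null p-values.\<close>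

lemma measurable_fdp_forward_stop:
  fixes x :: "'b \<Rightarrow> nat \<Rightarrow> real"
  assumes "\<And>i. i \<in> {1..k} \<Longrightarrow> (\<lambda>w. x w i) \<in> borel_measurable M"
  shows "(\<lambda>w. false_discovery_proportion N (forward_stop \<alpha> k (x w))) \<in> borel_measurable M"
  using assms
proof (induction k)
  case (Suc k)
  have "(\<lambda>w. \<Sum>i=1..Suc k. forward_stop_stat (x w) i) \<in> borel_measurable M"
    unfolding forward_stop_stat_def
    by (intro borel_measurable_sum borel_measurable_uminus borel_measurable_ln borel_measurable_diff
          borel_measurable_const Suc.prems) auto
  moreover have "(\<lambda>w. false_discovery_proportion N (forward_stop \<alpha> k (x w))) \<in> borel_measurable M"
    using Suc by simp
  ultimately show ?case
    unfolding forward_stop_Suc if_distrib[of "false_discovery_proportion N"] by measurable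
qed simp

section \<open>The probabilistic model: random nulls, with the non-nulls frozen at
  \<open>c\<close>\<close>

locale null_p_values = prob_space M for M :: "'a measure" +
  fixes p :: "nat \<Rightarrow> 'a \<Rightarrow> real" and c :: "nat \<Rightarrow> real"
    and m :: nat and N :: "nat set" and \<alpha> :: real
  assumes alpha_pos: "0 < \<alpha>"
    and nulls: "N \<subseteq> {1..m}"
    and p_range: "\<And>i \<omega>. i \<in> {1..m} \<Longrightarrow> \<omega> \<in> space M \<Longrightarrow> p i \<omega> \<in> {0<..<1}"
    and indep: "indep_vars (\<lambda>_. borel) p N"
    and uniform: "\<And>i. i \<in> N \<Longrightarrow>
           distributed M lborel (p i) (\<lambda>x. indicator {0..1} x / measure lborel {0..1::real})"
    and nonnull: "\<And>i \<omega>. i \<in> {1..m} - N \<Longrightarrow> \<omega> \<in> space M \<Longrightarrow> p i \<omega> = c i"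
begin

definition T :: "nat \<Rightarrow> 'a \<Rightarrow> real" where
  "T k \<omega> = null_stat_sum N k (\<lambda>i. p i \<omega>)"

definition fdp :: "nat \<Rightarrow> 'a \<Rightarrow> real" where
  "fdp k \<omega> = false_discovery_proportion N (forward_stop \<alpha> k (\<lambda>i. p i \<omega>))"

lemma p_bounds:
  assumes "i \<in> {1..m}" "\<omega> \<in> space M"
  shows "0 < p i \<omega>" "p i \<omega> < 1"
  using p_range[OF assms] by auto

lemma c_bounds:
  assumes "i \<in> {1..m} - N"
  shows "0 < c i \<and> c i < 1"
proof -
  \<comment> \<open>The constants inherit their range from \<open>p\<close> at any point of the
    nonempty sample space.\<close>
  obtain \<omega> where "\<omega> \<in> space M" using not_empty by blast
  with assms show ?thesis using p_bounds[of i \<omega>] nonnull[of i \<omega>] by auto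
qed

lemma measurable_null_p: "i \<in> N \<Longrightarrow> p i \<in> borel_measurable M"
  using distributed_measurable[OF uniform] by simp

lemma measurable_p: "i \<in> {1..m} \<Longrightarrow> p i \<in> borel_measurable M"
  using measurable_null_p nonnull by (cases "i \<in> N") (auto cong: measurable_cong)

lemma measurable_T: "k \<le> m \<Longrightarrow> T k \<in> borel_measurable M"
  unfolding T_def[abs_def] null_stat_sum_def forward_stop_stat_def
  by (intro borel_measurable_sum borel_measurable_uminus borel_measurable_ln borel_measurable_diff
        borel_measurable_const measurable_null_p) auto

lemma measurable_fdp: "k \<le> m \<Longrightarrow> fdp k \<in> borel_measurable M"
  unfolding fdp_def[abs_def] by (rule measurable_fdp_forward_stop) (auto intro!: measurable_p)

lemma fdp_nonneg: "0 \<le> fdp k \<omega>"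
  by (simp add: fdp_def false_discovery_proportion_nonneg)

lemma T_nonneg: "k \<le> m \<Longrightarrow> \<omega> \<in> space M \<Longrightarrow> 0 \<le> T k \<omega>"
  unfolding T_def by (rule null_stat_sum_nonneg) (auto simp: p_bounds)

lemma T_pos: "k \<le> m \<Longrightarrow> q \<in> N \<inter> {1..k} \<Longrightarrow> \<omega> \<in> space M \<Longrightarrow> 0 < T k \<omega>"
  unfolding T_def by (rule null_stat_sum_pos) (auto simp: p_bounds)

section \<open>Peeling off the last null\<close>

lemma last_null_cases:
  assumes "k \<le> m"
  obtains (none) "N \<inter> {1..k} = {}"
  | (last) q where "q \<in> N" "1 \<le> q" "q \<le> k" "N \<inter> {q<..k} = {}"
      "N \<inter> {1..k} = insert q (N \<inter> {1..q - 1})" "q \<notin> N \<inter> {1..q - 1}"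
proof (cases "N \<inter> {1..k} = {}")
  case False
  define q where "q = Max (N \<inter> {1..k})"
  have "q \<in> N \<inter> {1..k}" unfolding q_def by (rule Max_in) (use False in auto)
  moreover have "i \<le> q" if "i \<in> N \<inter> {1..k}" for i
    unfolding q_def by (rule Max_ge) (use that in auto)
  ultimately show ?thesis
    by (intro last[of q]) (fastforce simp: set_eq_iff)+
qed (rule none)

lemma T_last_null:
  assumes "N \<inter> {1..k} = insert q (N \<inter> {1..q - 1})" "q \<notin> N \<inter> {1..q - 1}"
  shows "T k \<omega> = T (q - 1) \<omega> + forward_stop_stat (\<lambda>i. p i \<omega>) q"
  unfolding T_def null_stat_sum_def assms(1) using assms(2) by simp

text \<open>The earlier null p-values, taken as one vector, are independent of \<open>p q\<close>,
  whose statistic is standard exponential. The functional \<open>G\<close> is later taken to be the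
  constant 1 or the false discovery proportion up to \<open>q - 1\<close>.\<close>

lemma nn_integral_tilted_last_null:
  assumes q: "q \<in> N" "N \<inter> {1..k} = insert q (N \<inter> {1..q - 1})" "q \<notin> N \<inter> {1..q - 1}"
    and G [measurable]: "G \<in> borel_measurable (PiM (N \<inter> {1..q - 1}) (\<lambda>_. borel))"
  shows "(\<integral>\<^sup>+\<omega>. G (restrict (\<lambda>i. p i \<omega>) (N \<inter> {1..q - 1})) * ennreal (exp (T k \<omega>))
            * indicator {a<..t} (T k \<omega>) \<partial>M)
    = (\<integral>\<^sup>+s. (\<integral>\<^sup>+\<omega>. G (restrict (\<lambda>i. p i \<omega>) (N \<inter> {1..q - 1})) * ennreal (exp (T (q - 1) \<omega>))
            * indicator {..s} (T (q - 1) \<omega>) \<partial>M) * indicator {a<..t} s \<partial>lborel)"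
proof -
  let ?I = "N \<inter> {1..q - 1}"
  let ?\<eta> = "\<lambda>u::nat \<Rightarrow> real. - ln (1 - u q)"
  have ind: "indep_var (PiM ?I (\<lambda>_. borel)) (\<lambda>\<omega>. restrict (\<lambda>i. p i \<omega>) ?I)
      (PiM {q} (\<lambda>_. borel)) (\<lambda>\<omega>. restrict (\<lambda>i. p i \<omega>) {q})"
    by (rule indep_var_restrict[OF indep]) (use q in auto)
  have \<tau>: "null_stat_sum N (q - 1) \<in> borel_measurable (PiM ?I (\<lambda>_. borel))"
    by (rule measurable_null_stat_sum) simp
  have \<eta>: "?\<eta> \<in> borel_measurable (PiM {q} (\<lambda>_. borel))"
    by measurable
  have D: "distributed M lborel (\<lambda>\<omega>. ?\<eta> (restrict (\<lambda>i. p i \<omega>) {q})) (exponential_density 1)"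
    using exponential_distributed_of_uniform[OF uniform[of q]] q(1) nulls p_bounds by auto
  have "(\<integral>\<^sup>+\<omega>. G (restrict (\<lambda>i. p i \<omega>) ?I)
        * ennreal (exp (null_stat_sum N (q - 1) (restrict (\<lambda>i. p i \<omega>) ?I) + ?\<eta> (restrict (\<lambda>i. p i \<omega>) {q})))
        * indicator {a<..t} (null_stat_sum N (q - 1) (restrict (\<lambda>i. p i \<omega>) ?I) + ?\<eta> (restrict (\<lambda>i. p i \<omega>) {q})) \<partial>M)
    = (\<integral>\<^sup>+s. (\<integral>\<^sup>+\<omega>. G (restrict (\<lambda>i. p i \<omega>) ?I)
        * ennreal (exp (null_stat_sum N (q - 1) (restrict (\<lambda>i. p i \<omega>) ?I)))
        * indicator {..s} (null_stat_sum N (q - 1) (restrict (\<lambda>i. p i \<omega>) ?I)) \<partial>M) * indicator {a<..t} s \<partial>lborel)"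
    by (rule nn_integral_tilted_add_exponential[OF ind G \<tau> \<eta>]) (rule D)
  moreover have "null_stat_sum N (q - 1) (restrict (\<lambda>i. p i \<omega>) ?I) = T (q - 1) \<omega>" for \<omega>
    by (simp add: T_def null_stat_sum_def forward_stop_stat_def)
  moreover have "T k \<omega> = T (q - 1) \<omega> + ?\<eta> (restrict (\<lambda>i. p i \<omega>) {q})" for \<omega>
    using T_last_null[OF q(2,3)] by (simp add: forward_stop_stat_def)
  ultimately show ?thesis by simp
qed

text \<open>The bound is the volume of the simplex of nonnegative vectors with sum at most
  \<open>t\<close>, one coordinate per null: under the tilt the null statistics have Lebesgue
  measure on the orthant as their law.\<close>

lemma nn_integral_tilted_null_sum:
  assumes "k \<le> m" "0 \<le> t"
  shows "(\<integral>\<^sup>+\<omega>. ennreal (exp (T k \<omega>)) * indicator {..t} (T k \<omega>) \<partial>M)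
    \<le> ennreal (t ^ card (N \<inter> {1..k}) / fact (card (N \<inter> {1..k})))"
  using assms
proof (induction k arbitrary: t rule: less_induct)
  case (less k)
  from \<open>k \<le> m\<close> show ?case
  proof (cases rule: last_null_cases)
    case none
    then have "T k \<omega> = 0" for \<omega> by (simp add: T_def null_stat_sum_def)
    then show ?thesis using none \<open>0 \<le> t\<close> by (simp add: emeasure_space_1)
  next
    case (last q)
    define j where "j = card (N \<inter> {1..q - 1})"
    have card: "card (N \<inter> {1..k}) = Suc j"
      using last(5,6) by (simp add: j_def)
    \<comment> \<open>Positivity of \<open>T k\<close> allows \<open>{..t}\<close> to become
      \<open>{0<..t}\<close>; the factor 1 plays the part of \<open>G\<close>.\<close>
    have "(\<integral>\<^sup>+\<omega>. ennreal (exp (T k \<omega>)) * indicator {..t} (T k \<omega>) \<partial>M)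
        = (\<integral>\<^sup>+\<omega>. 1 * ennreal (exp (T k \<omega>)) * indicator {0<..t} (T k \<omega>) \<partial>M)"
      using T_pos[of k q] last less.prems by (intro nn_integral_cong) (auto split: split_indicator)
    also have "\<dots> = (\<integral>\<^sup>+s. (\<integral>\<^sup>+\<omega>. 1 * ennreal (exp (T (q - 1) \<omega>))
            * indicator {..s} (T (q - 1) \<omega>) \<partial>M) * indicator {0<..t} s \<partial>lborel)"
      by (rule nn_integral_tilted_last_null) (use last in auto)
    also have "\<dots> \<le> (\<integral>\<^sup>+s. ennreal (1 * (real (Suc j) * s ^ (Suc j - 1) / fact (Suc j)))
        * indicator {0<..t} s \<partial>lborel)"
    proof (rule nn_integral_mono)
      fix s :: real
      have "(\<integral>\<^sup>+\<omega>. ennreal (exp (T (q - 1) \<omega>)) * indicator {..s} (T (q - 1) \<omega>) \<partial>M)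
          \<le> ennreal (s ^ j / fact j)" if "0 < s"
        unfolding j_def by (rule less.IH) (use that last less.prems in auto)
      moreover have "real (Suc j) * s ^ j / fact (Suc j) = s ^ j / fact j"
        by (simp add: field_simps del: of_nat_Suc)
      ultimately show "(\<integral>\<^sup>+\<omega>. 1 * ennreal (exp (T (q - 1) \<omega>)) * indicator {..s} (T (q - 1) \<omega>) \<partial>M)
            * indicator {0<..t} s
          \<le> ennreal (1 * (real (Suc j) * s ^ (Suc j - 1) / fact (Suc j))) * indicator {0<..t} s"
        by (simp split: split_indicator del: fact_Suc)
    qed
    also have "\<dots> = ennreal (t ^ Suc j / fact (Suc j))"
      using nn_integral_scaled_power_deriv[of 0 t 1 "Suc j"] \<open>0 \<le> t\<close> by simp
    finally show ?thesis unfolding card .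
  qed
qed

text \<open>Exhibits \<open>fdp\<close> as a function of the null vector alone, the form in which
  independence of the last null can be applied.\<close>

lemma fdp_depends_on_nulls:
  assumes "\<omega> \<in> space M" "k \<le> m"
  shows "fdp k \<omega> = false_discovery_proportion N (forward_stop \<alpha> k
    (\<lambda>i. if i \<in> N \<inter> {1..k} then restrict (\<lambda>i. p i \<omega>) (N \<inter> {1..k}) i else c i))"
  unfolding fdp_def
  by (intro arg_cong[where f = "false_discovery_proportion N"] forward_stop_cong)
    (use assms nonnull in auto)

text \<open>The threshold depends on \<open>c\<close> but not on the sample point, so the range of
  the null sum can be cut at a constant.\<close>

lemma fdp_le_threshold:
  assumes "q \<in> N" "1 \<le> q" "q \<le> k" "N \<inter> {q<..k} = {}" "k \<le> m"
  obtains C where "0 \<le> C" "\<And>\<omega>. \<omega> \<in> space M \<Longrightarrow>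
    fdp k \<omega> \<le> (if T k \<omega> \<le> C then \<alpha> * card (N \<inter> {1..k}) / C else fdp (q - 1) \<omega>)"
proof -
  have "\<exists>C. 0 \<le> C \<and> C \<le> \<alpha> * k \<and>
    (\<forall>x. (\<forall>i\<in>{1..k}. 0 < x i \<and> x i < 1) \<longrightarrow> (\<forall>i\<in>{1..k} - N. x i = c i) \<longrightarrow>
      false_discovery_proportion N (forward_stop \<alpha> k x) \<le>
        (if null_stat_sum N k x \<le> C then \<alpha> * card (N \<inter> {1..k}) / C
         else false_discovery_proportion N (forward_stop \<alpha> (q - 1) x)))"
    by (rule fdp_threshold) (use assms alpha_pos c_bounds in auto)
  then obtain C where "0 \<le> C" and C:
    "\<And>x. \<lbrakk>\<forall>i\<in>{1..k}. 0 < x i \<and> x i < 1; \<forall>i\<in>{1..k} - N. x i = c i\<rbrakk> \<Longrightarrow>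
      false_discovery_proportion N (forward_stop \<alpha> k x) \<le>
        (if null_stat_sum N k x \<le> C then \<alpha> * card (N \<inter> {1..k}) / C
         else false_discovery_proportion N (forward_stop \<alpha> (q - 1) x))"
    by auto
  show ?thesis
  proof (rule that[OF \<open>0 \<le> C\<close>])
    fix \<omega> assume "\<omega> \<in> space M"
    then show "fdp k \<omega> \<le> (if T k \<omega> \<le> C then \<alpha> * card (N \<inter> {1..k}) / C else fdp (q - 1) \<omega>)"
      unfolding fdp_def T_def by (intro C) (use assms p_bounds nonnull in auto)
  qed
qed

lemma nn_integral_tilted_fdp_le:
  assumes "k \<le> m" "0 < t"
  defines "j \<equiv> \<lambda>k. card (N \<inter> {1..k})"
  shows "(\<integral>\<^sup>+\<omega>. ennreal (fdp k \<omega>) * ennreal (exp (T k \<omega>)) * indicator {..t} (T k \<omega>) \<partial>M)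
    \<le> ennreal (\<alpha> * (real (j k) * t ^ (j k - 1) / fact (j k)))"
  using assms(1,2)
proof (induction k arbitrary: t rule: less_induct)
  case (less k)
  note [measurable] = measurable_T[OF \<open>k \<le> m\<close>] measurable_fdp[OF \<open>k \<le> m\<close>]
  from \<open>k \<le> m\<close> show ?case
  proof (cases rule: last_null_cases)
    case none
    then have "fdp k \<omega> = 0" for \<omega>
      unfolding fdp_def by (rule false_discovery_proportion_no_null) (rule forward_stop_le)
    then show ?thesis by simp
  next
    case (last q)
    have "q - 1 \<le> m" "q - 1 < k" using last less.prems by auto
    note [measurable] = measurable_T[OF \<open>q - 1 \<le> m\<close>] measurable_fdp[OF \<open>q - 1 \<le> m\<close>]
    define i where "i = j (q - 1)"
    have jk: "j k = Suc i" using last(5,6) by (simp add: i_def j_def)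
    obtain C where C: "0 \<le> C" and threshold: "\<And>\<omega>. \<omega> \<in> space M \<Longrightarrow>
        fdp k \<omega> \<le> (if T k \<omega> \<le> C then \<alpha> * Suc i / C else fdp (q - 1) \<omega>)"
      using fdp_le_threshold[OF last(1-4) \<open>k \<le> m\<close>] jk by (metis j_def)
    \<comment> \<open>The simplex volume gives \<open>\<alpha> * r ^ i / fact i\<close> times
      \<open>r / C\<close>, and \<open>r / C \<le> 1\<close>. If \<open>C = 0\<close> then
      \<open>r = 0\<close>, and the quotient is 0 by convention.\<close>
    have below: "(\<integral>\<^sup>+\<omega>. ennreal (\<alpha> * Suc i / C) * (ennreal (exp (T k \<omega>)) * indicator {..r} (T k \<omega>)) \<partial>M)
        \<le> ennreal (\<alpha> * r ^ i / fact i)" if "0 \<le> r" "r \<le> C" for r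
    proof -
      have "(\<integral>\<^sup>+\<omega>. ennreal (\<alpha> * Suc i / C) * (ennreal (exp (T k \<omega>)) * indicator {..r} (T k \<omega>)) \<partial>M)
          \<le> ennreal (\<alpha> * Suc i / C) * ennreal (r ^ Suc i / fact (Suc i))"
        using nn_integral_tilted_null_sum[OF \<open>k \<le> m\<close> \<open>0 \<le> r\<close>] jk
        by (subst nn_integral_cmult) (auto simp: j_def intro!: mult_left_mono)
      also have "\<dots> = ennreal (\<alpha> * Suc i / C * (r ^ Suc i / fact (Suc i)))"
        using that C alpha_pos by (intro ennreal_mult[symmetric]) auto
      also have "\<alpha> * Suc i / C * (r ^ Suc i / fact (Suc i)) = (\<alpha> * r ^ i / fact i) * (r / C)"
        by (simp add: field_simps del: of_nat_Suc)
      also have "\<dots> \<le> (\<alpha> * r ^ i / fact i) * 1"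
        using that C alpha_pos by (intro mult_left_mono) (auto simp: divide_le_eq_1)
      finally show ?thesis by (simp add: ennreal_leI)
    qed
    have target: "\<alpha> * (real (j k) * t ^ (j k - 1) / fact (j k)) = \<alpha> * t ^ i / fact i"
      unfolding jk by (simp add: field_simps del: of_nat_Suc)
    show ?thesis
    proof (cases "t \<le> C")
      case True
      \<comment> \<open>On \<open>T k \<omega> \<le> t \<le> C\<close> only the first branch of the
        threshold bound occurs.\<close>
      have "(\<integral>\<^sup>+\<omega>. ennreal (fdp k \<omega>) * ennreal (exp (T k \<omega>)) * indicator {..t} (T k \<omega>) \<partial>M)
          \<le> (\<integral>\<^sup>+\<omega>. ennreal (\<alpha> * Suc i / C) * (ennreal (exp (T k \<omega>)) * indicator {..t} (T k \<omega>)) \<partial>M)"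
      proof (rule nn_integral_mono)
        fix \<omega> assume "\<omega> \<in> space M"
        then show "ennreal (fdp k \<omega>) * ennreal (exp (T k \<omega>)) * indicator {..t} (T k \<omega>)
            \<le> ennreal (\<alpha> * Suc i / C) * (ennreal (exp (T k \<omega>)) * indicator {..t} (T k \<omega>))"
          using threshold[of \<omega>] True
          by (auto split: split_indicator intro!: mult_right_mono ennreal_leI)
      qed
      also have "\<dots> \<le> ennreal (\<alpha> * t ^ i / fact i)"
        using below[of t] True \<open>0 < t\<close> by simp
      finally show ?thesis unfolding target .
    next
      case False
      let ?I = "N \<inter> {1..q - 1}"
      \<comment> \<open>Filling the non-null coordinates with \<open>c\<close> makes
        \<open>G\<close> a measurable function on the product space of the nulls before
        \<open>q\<close>.\<close>
      define G where "G w = ennreal (false_discovery_proportion N (forward_stop \<alpha> (q - 1)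
          (\<lambda>i. if i \<in> ?I then w i else c i)))" for w
      have "(\<lambda>w. if l \<in> ?I then w l else c l) \<in> borel_measurable (PiM ?I (\<lambda>_. borel))" for l
        using measurable_component_singleton[of l ?I "\<lambda>_. borel :: real measure"]
        by (cases "l \<in> ?I") (simp_all only: if_True if_False borel_measurable_const)
      then have G: "G \<in> borel_measurable (PiM ?I (\<lambda>_. borel))"
        unfolding G_def by (intro measurable_compose[OF measurable_fdp_forward_stop measurable_ennreal])
      have G_fdp: "G (restrict (\<lambda>i. p i \<omega>) ?I) = ennreal (fdp (q - 1) \<omega>)" if "\<omega> \<in> space M" for \<omega>
        unfolding G_def fdp_depends_on_nulls[OF that \<open>q - 1 \<le> m\<close>] ..
      \<comment> \<open>The event \<open>T k \<omega> \<le> t\<close> is cut at \<open>C\<close>,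
        one piece for each branch of the threshold bound.\<close>
      have "(\<integral>\<^sup>+\<omega>. ennreal (fdp k \<omega>) * ennreal (exp (T k \<omega>)) * indicator {..t} (T k \<omega>) \<partial>M)
          \<le> (\<integral>\<^sup>+\<omega>. ennreal (\<alpha> * Suc i / C) * (ennreal (exp (T k \<omega>)) * indicator {..C} (T k \<omega>))
              + ennreal (fdp (q - 1) \<omega>) * ennreal (exp (T k \<omega>)) * indicator {C<..t} (T k \<omega>) \<partial>M)"
      proof (rule nn_integral_mono)
        fix \<omega> assume "\<omega> \<in> space M"
        then show "ennreal (fdp k \<omega>) * ennreal (exp (T k \<omega>)) * indicator {..t} (T k \<omega>)
            \<le> ennreal (\<alpha> * Suc i / C) * (ennreal (exp (T k \<omega>)) * indicator {..C} (T k \<omega>))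
              + ennreal (fdp (q - 1) \<omega>) * ennreal (exp (T k \<omega>)) * indicator {C<..t} (T k \<omega>)"
          using threshold[of \<omega>] False
          by (auto split: split_indicator if_splits intro!: mult_right_mono ennreal_leI)
      qed
      also have "\<dots> = (\<integral>\<^sup>+\<omega>. ennreal (\<alpha> * Suc i / C) * (ennreal (exp (T k \<omega>)) * indicator {..C} (T k \<omega>)) \<partial>M)
          + (\<integral>\<^sup>+\<omega>. ennreal (fdp (q - 1) \<omega>) * ennreal (exp (T k \<omega>)) * indicator {C<..t} (T k \<omega>) \<partial>M)"
        by (rule nn_integral_add) measurable
      also have "\<dots> \<le> ennreal (\<alpha> * C ^ i / fact i) + ennreal (\<alpha> * (t ^ i - C ^ i) / fact i)"
      proof (rule add_mono)
        show "(\<integral>\<^sup>+\<omega>. ennreal (\<alpha> * Suc i / C) * (ennreal (exp (T k \<omega>)) * indicator {..C} (T k \<omega>)) \<partial>M)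
            \<le> ennreal (\<alpha> * C ^ i / fact i)"
          using below[of C] C by simp
        have "(\<integral>\<^sup>+\<omega>. ennreal (fdp (q - 1) \<omega>) * ennreal (exp (T k \<omega>)) * indicator {C<..t} (T k \<omega>) \<partial>M)
            = (\<integral>\<^sup>+\<omega>. G (restrict (\<lambda>i. p i \<omega>) ?I) * ennreal (exp (T k \<omega>)) * indicator {C<..t} (T k \<omega>) \<partial>M)"
          by (intro nn_integral_cong) (simp only: G_fdp)
        also have "\<dots> = (\<integral>\<^sup>+s. (\<integral>\<^sup>+\<omega>. G (restrict (\<lambda>i. p i \<omega>) ?I) * ennreal (exp (T (q - 1) \<omega>))
            * indicator {..s} (T (q - 1) \<omega>) \<partial>M) * indicator {C<..t} s \<partial>lborel)"
          by (rule nn_integral_tilted_last_null) (use last G in auto)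
        also have "\<dots> = (\<integral>\<^sup>+s. (\<integral>\<^sup>+\<omega>. ennreal (fdp (q - 1) \<omega>) * ennreal (exp (T (q - 1) \<omega>))
            * indicator {..s} (T (q - 1) \<omega>) \<partial>M) * indicator {C<..t} s \<partial>lborel)"
          by (intro nn_integral_cong arg_cong2[where f = "(*)"] refl) (simp only: G_fdp)
        \<comment> \<open>The induction hypothesis applies because \<open>0 \<le> C < s\<close>. For
          \<open>i = 0\<close> its bound is 0, in agreement with
          \<open>t ^ 0 - C ^ 0 = 0\<close>.\<close>
        also have "\<dots> \<le> (\<integral>\<^sup>+s. ennreal (\<alpha> * (real i * s ^ (i - 1) / fact i)) * indicator {C<..t} s \<partial>lborel)"
          using less.IH[OF \<open>q - 1 < k\<close> \<open>q - 1 \<le> m\<close>] C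
          by (intro nn_integral_mono) (auto simp: i_def split: split_indicator)
        also have "\<dots> = ennreal (\<alpha> * (t ^ i - C ^ i) / fact i)"
          using C False alpha_pos by (intro nn_integral_scaled_power_deriv) auto
        finally show "(\<integral>\<^sup>+\<omega>. ennreal (fdp (q - 1) \<omega>) * ennreal (exp (T k \<omega>)) * indicator {C<..t} (T k \<omega>) \<partial>M)
            \<le> ennreal (\<alpha> * (t ^ i - C ^ i) / fact i)" .
      qed
      also have "\<dots> = ennreal (\<alpha> * C ^ i / fact i + \<alpha> * (t ^ i - C ^ i) / fact i)"
        using C alpha_pos power_mono[of C t i] False by (intro ennreal_plus[symmetric]) auto
      also have "\<alpha> * C ^ i / fact i + \<alpha> * (t ^ i - C ^ i) / fact i = \<alpha> * t ^ i / fact i"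
        by (simp add: add_divide_distrib[symmetric] distrib_left[symmetric])
      finally show ?thesis unfolding target .
    qed
  qed
qed

section \<open>Removing the tilt\<close>

lemma expectation_fdp_le: "expectation (fdp m) \<le> \<alpha>"
proof -
  define n where "n = card (N \<inter> {1..m})"
  note [measurable] = measurable_T[OF order_refl] measurable_fdp[OF order_refl]
  interpret pair_sigma_finite M "lborel :: real measure" ..
  let ?E = "\<lambda>\<omega>. ennreal (fdp m \<omega>) * ennreal (exp (T m \<omega>))"
  have exp_tail: "(\<integral>\<^sup>+s. ennreal (exp (- s)) * indicator {r..} s \<partial>lborel) = ennreal (exp (- r))" for r :: real
  proof -
    have "((\<lambda>s::real. - exp (- s)) \<longlongrightarrow> - 0) at_top"
      by (intro tendsto_minus filterlim_compose[OF exp_at_bot] filterlim_uminus_at_bot_at_top)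
    moreover have "((\<lambda>s. - exp (- s)) has_real_derivative exp (- s)) (at s)" for s :: real
      by (auto intro!: derivative_eq_intros)
    ultimately show ?thesis
      using nn_integral_FTC_atLeast[of "\<lambda>s. exp (- s)" r "\<lambda>s. - exp (- s)" 0] by simp
  qed
  \<comment> \<open>The factor 1 is written as \<open>exp (T m \<omega>)\<close> times the tail
    integral of \<open>exp (- s)\<close> from \<open>T m \<omega>\<close>. Exchanging the integrals
    then exposes the tilted quantity at each level \<open>s\<close>.\<close>
  have "(\<integral>\<^sup>+\<omega>. ennreal (fdp m \<omega>) \<partial>M)
      = (\<integral>\<^sup>+\<omega>. ?E \<omega> * (\<integral>\<^sup>+s. ennreal (exp (- s)) * indicator {T m \<omega>..} s \<partial>lborel) \<partial>M)"
    by (intro nn_integral_cong)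
      (simp add: exp_tail mult.assoc ennreal_mult[symmetric] exp_add[symmetric])
  also have "\<dots> = (\<integral>\<^sup>+\<omega>. (\<integral>\<^sup>+s. ?E \<omega> * (ennreal (exp (- s)) * indicator {T m \<omega>..} s) \<partial>lborel) \<partial>M)"
    by (intro nn_integral_cong nn_integral_cmult[symmetric]) auto
  also have "\<dots> = (\<integral>\<^sup>+s. (\<integral>\<^sup>+\<omega>. ?E \<omega> * (ennreal (exp (- s)) * indicator {T m \<omega>..} s) \<partial>M) \<partial>lborel)"
  proof (rule Fubini'[symmetric])
    have "(\<lambda>(\<omega>, s). ?E \<omega> * (ennreal (exp (- s)) * (if T m \<omega> \<le> s then 1 else 0)))
        \<in> borel_measurable (M \<Otimes>\<^sub>M lborel)" by measurable
    then show "(\<lambda>(\<omega>, s). ?E \<omega> * (ennreal (exp (- s)) * indicator {T m \<omega>..} s))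
        \<in> borel_measurable (M \<Otimes>\<^sub>M lborel)"
      by (simp add: indicator_def of_bool_def)
  qed
  also have "\<dots> = (\<integral>\<^sup>+s. ennreal (exp (- s)) * (\<integral>\<^sup>+\<omega>. ?E \<omega> * indicator {..s} (T m \<omega>) \<partial>M) \<partial>lborel)"
    by (subst nn_integral_cmult[symmetric])
      (auto intro!: nn_integral_cong simp: ac_simps split: split_indicator)
  also have "\<dots> \<le> (\<integral>\<^sup>+s. ennreal (\<alpha> * real n / fact n) * (ennreal (s ^ (n - 1) * exp (- s)) * indicator {0..} s) \<partial>lborel)"
  proof (rule nn_integral_mono_AE)
    \<comment> \<open>The tilted bound covers \<open>s > 0\<close>, nonnegativity of
      \<open>T m\<close> makes the inner integral vanish for \<open>s < 0\<close>, and the point 0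
      is a null set.\<close>
    have "ennreal (exp (- s)) * (\<integral>\<^sup>+\<omega>. ?E \<omega> * indicator {..s} (T m \<omega>) \<partial>M)
        \<le> ennreal (\<alpha> * real n / fact n) * (ennreal (s ^ (n - 1) * exp (- s)) * indicator {0..} s)"
      if "s \<noteq> 0" for s :: real
    proof (cases "0 < s")
      case True
      have "ennreal (exp (- s)) * (\<integral>\<^sup>+\<omega>. ?E \<omega> * indicator {..s} (T m \<omega>) \<partial>M)
          \<le> ennreal (exp (- s)) * ennreal (\<alpha> * (real n * s ^ (n - 1) / fact n))"
        using nn_integral_tilted_fdp_le[OF order_refl True] by (auto simp: n_def intro!: mult_left_mono)
      also have "\<dots> = ennreal (\<alpha> * real n / fact n) * (ennreal (s ^ (n - 1) * exp (- s)) * indicator {0..} s)"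
        using True alpha_pos by (simp add: ennreal_mult[symmetric] ac_simps)
      finally show ?thesis .
    next
      case False
      then have "(\<integral>\<^sup>+\<omega>. ?E \<omega> * indicator {..s} (T m \<omega>) \<partial>M) = (\<integral>\<^sup>+\<omega>. 0 \<partial>M)"
        using that T_nonneg[OF order_refl]
        by (intro nn_integral_cong) (force split: split_indicator)
      then show ?thesis by simp
    qed
    then show "AE s in lborel. ennreal (exp (- s)) * (\<integral>\<^sup>+\<omega>. ?E \<omega> * indicator {..s} (T m \<omega>) \<partial>M)
        \<le> ennreal (\<alpha> * real n / fact n) * (ennreal (s ^ (n - 1) * exp (- s)) * indicator {0..} s)"
      using AE_lborel_singleton[of "0::real"] by (auto elim: eventually_mono)
  qed
  \<comment> \<open>The Gamma integral yields \<open>fact (n - 1)\<close>, hence the total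
    \<open>\<alpha>\<close> when \<open>n > 0\<close>. For \<open>n = 0\<close> the subtraction
    gives exponent 0 and the factor \<open>real n\<close> makes the product 0.\<close>
  also have "\<dots> = ennreal (\<alpha> * real n / fact n) * ennreal (fact (n - 1))"
    by (subst nn_integral_cmult) (auto simp: nn_intergal_power_times_exp_Ici)
  also have "\<dots> = ennreal (\<alpha> * real n / fact n * fact (n - 1))"
    using alpha_pos by (intro ennreal_mult[symmetric]) auto
  also have "\<dots> \<le> ennreal \<alpha>"
    using alpha_pos by (cases n) (auto simp: field_simps simp del: of_nat_Suc intro!: ennreal_leI)
  finally have "(\<integral>\<^sup>+\<omega>. ennreal (fdp m \<omega>) \<partial>M) \<le> ennreal \<alpha>" .
  then show ?thesis
    using alpha_pos fdp_nonneg by (intro integral_real_bounded) auto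
qed

end

theorem theorem2:
  fixes M :: "'a measure" and p :: "nat \<Rightarrow> 'a \<Rightarrow> real" and c :: "nat \<Rightarrow> real"
    and m :: nat and N :: "nat set" and \<alpha> :: real
  assumes "prob_space M"
    and "m \<ge> 1"
    and "0 < \<alpha>" and "\<alpha> < 1"
    and "N \<subseteq> {1..m}"
    and "\<And>i \<omega>. i \<in> {1..m} \<Longrightarrow> \<omega> \<in> space M \<Longrightarrow> p i \<omega> \<in> {0<..<1}"
    and "prob_space.indep_vars M (\<lambda>_. borel) p N"
    and "\<And>i. i \<in> N \<Longrightarrow>
           distributed M lborel (p i) (\<lambda>x. indicator {0..1} x / measure lborel {0..1::real})"
    and "\<And>i \<omega>. i \<in> {1..m} - N \<Longrightarrow> \<omega> \<in> space M \<Longrightarrow> p i \<omega> = c i"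
  shows "prob_space.expectation M
           (\<lambda>\<omega>. false_discovery_proportion N (forward_stop \<alpha> m (\<lambda>i. p i \<omega>))) \<le> \<alpha>"
proof -
  interpret prob_space M by fact
  interpret null_p_values M p c m N \<alpha>
    using assms by unfold_locales auto
  show ?thesis
    using expectation_fdp_le unfolding fdp_def .
qed

end
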